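(* Let $n\ge 3$, $b>2$, and let $\widetilde b\in\mathbb{R}$ be such that $\widetilde T_n$ is nonsingular. Then $$\operatorname{Tr}(\widetilde T_n^{-1})=K_1\left(\frac{n+1}{\sqrt{b^2-4}}\,\frac{\gamma_{\frac{n+1}{2}}^2+2}{\gamma_{n+1}}-\frac{b}{b^2-4}\right)-K_2\left(\frac{b}{\sqrt{b^2-4}}\left(\gamma_{\frac{n+1}{2}}^2+2\right)-\gamma_{n+1}-\frac{4(n+1)}{\gamma_{n+1}}\right),$$ where $$K_1=\frac{[\gamma_{n+1}+(\widetilde b-b)\gamma_n]^2+(\widetilde b-b)^2(b^2-4)}{[\gamma_{n+1}+(\widetilde b-b)\gamma_n]^2-(\widetilde b-b)^2(b^2-4)},\qquad K_2=\frac{(\widetilde b-b)[\gamma_{n+1}+(\widetilde b-b)\gamma_n]}{[\gamma_{n+1}+(\widetilde b-b)\gamma_n]^2-(\widetilde b-b)^2(b^2-4)}.$$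
   Context: For an integer $n\ge 3$ and real $b,\widetilde b$, $\widetilde T_n$ is the $n\times n$ real symmetric tridiagonal matrix with diagonal entries $(\widetilde b,b,b,\dots,b,\widetilde b)$ (first and last equal to $\widetilde b$, all others equal to $b$) and all sub- and superdiagonal entries equal to $-1$. For $b>2$ put $r_1=\tfrac12(b+\sqrt{b^2-4})$, $r_2=\tfrac12(b-\sqrt{b^2-4})$ (both positive) and $\gamma_k=r_1^k-r_2^k$ for real $k\ge 0$ (in particular half-integer $k$ is allowed). *)

theory Defs
  imports Complex_Main "Jordan_Normal_Form.Gauss_Jordan_Elimination"
begin

text \<open>Matrix indices run from \<open>0\<close> to \<open>n - 1\<close>. The parameter \<open>c\<close> is the corner entry
  (written b tilde in the mathematics).\<close>

definition T_tilde :: "nat \<Rightarrow> real \<Rightarrow> real \<Rightarrow> real mat" where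
  "T_tilde n b c = mat n n (\<lambda>(i, j).
     if i = j then (if i = 0 \<or> i = n - 1 then c else b)
     else if i = Suc j \<or> j = Suc i then -1
     else 0)"

definition mat_trace :: "'a :: comm_monoid_add mat \<Rightarrow> 'a" where
  "mat_trace A = (\<Sum>i<dim_row A. A $$ (i, i))"

text \<open>The library inverse \<^const>\<open>mat_inverse\<close> is option-valued; on invertible matrices
  it always returns the inverse, so selecting its value is harmless there.\<close>

abbreviation mat_inv :: "'a :: field mat \<Rightarrow> 'a mat" where
  "mat_inv A \<equiv> the (mat_inverse A)"

lemma mat_inv_invertible:
  fixes A :: "'a :: field mat"
  assumes "invertible_mat A"
  shows "inverts_mat A (mat_inv A)" and "inverts_mat (mat_inv A) A"
    and "mat_inv A \<in> carrier_mat (dim_row A) (dim_row A)"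
proof -
  define n where "n = dim_row A"
  obtain B where sq: "dim_row A = dim_col A"
    and AB: "A * B = 1\<^sub>m (dim_row A)" and BA: "B * A = 1\<^sub>m (dim_row B)"
    using assms by (auto simp: invertible_mat_def inverts_mat_def)
  have A: "A \<in> carrier_mat n n" using sq by (auto simp: n_def)
  have "dim_col B = n" using arg_cong[OF AB, of dim_col] by (simp add: n_def)
  moreover have "dim_row B = n" using arg_cong[OF BA, of dim_col] sq by (simp add: n_def)
  ultimately have B: "B \<in> carrier_mat n n" by (rule carrier_matI[rotated])
  have "A * B = 1\<^sub>m n" "B * A = 1\<^sub>m n"
    using AB BA A B by (simp_all only: carrier_matD)
  then have "\<exists>X\<in>carrier_mat n n. X * A = 1\<^sub>m n \<and> A * X = 1\<^sub>m n"
    using B by (intro bexI[of _ B] conjI)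
  then have "A \<in> Units (ring_mat TYPE('a) n ())"
    using A by (simp add: Units_def ring_mat_simps)
  then obtain C where C: "mat_inverse A = Some C"
    using mat_inverse(1)[OF A, where b = "()"] by (cases "mat_inverse A") auto
  have mA: "mat_inv A = C" using C by simp
  have AC: "A * C = 1\<^sub>m n" and CA: "C * A = 1\<^sub>m n" and Cn: "C \<in> carrier_mat n n"
    using mat_inverse(2)[OF A C] by blast+
  show "inverts_mat A (mat_inv A)" "inverts_mat (mat_inv A) A"
    "mat_inv A \<in> carrier_mat (dim_row A) (dim_row A)"
    unfolding mA inverts_mat_def using A AC CA Cn by (simp_all only: carrier_matD)
qed

definition r1 :: "real \<Rightarrow> real" where
  "r1 b = (b + sqrt (b\<^sup>2 - 4)) / 2"

definition r2 :: "real \<Rightarrow> real" where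
  "r2 b = (b - sqrt (b\<^sup>2 - 4)) / 2"

text \<open>Real exponents, since half-integer indices occur; both bases are positive for \<open>b > 2\<close>.\<close>

definition gam :: "real \<Rightarrow> real \<Rightarrow> real" where
  "gam b k = r1 b powr k - r2 b powr k"

definition K1 :: "nat \<Rightarrow> real \<Rightarrow> real \<Rightarrow> real" where
  "K1 n b c =
     ((gam b (real n + 1) + (c - b) * gam b (real n))\<^sup>2 + (c - b)\<^sup>2 * (b\<^sup>2 - 4)) /
     ((gam b (real n + 1) + (c - b) * gam b (real n))\<^sup>2 - (c - b)\<^sup>2 * (b\<^sup>2 - 4))"

definition K2 :: "nat \<Rightarrow> real \<Rightarrow> real \<Rightarrow> real" where
  "K2 n b c =
     ((c - b) * (gam b (real n + 1) + (c - b) * gam b (real n))) /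
     ((gam b (real n + 1) + (c - b) * gam b (real n))\<^sup>2 - (c - b)\<^sup>2 * (b\<^sup>2 - 4))"

end

theory Submission
  imports Defs
begin

text \<open>
  The inverse of a tridiagonal matrix is explicit: its entry at \<open>i \<le> j\<close> is \<open>\<phi>\<^sub>i \<psi>\<^sub>j / W\<close>, where
  \<open>\<phi>\<close> and \<open>\<psi>\<close> solve the three-term recurrence with the left, respectively right, boundary
  condition and \<open>W\<close> is their constant Casoratian. For the present matrix
  \<open>\<phi>\<^sub>k = \<alpha> r\<^sub>1\<^sup>k - \<beta> r\<^sub>2\<^sup>k\<close> with \<open>\<alpha> = r\<^sub>1 + c - b\<close> and \<open>\<beta> = r\<^sub>2 + c - b\<close>, and by symmetry
  \<open>\<psi>\<^sub>j = \<phi>\<^bsub>n-1-j\<^esub>\<close>. As \<open>r\<^sub>1 r\<^sub>2 = 1\<close>, the sum of \<open>\<phi>\<^sub>i \<phi>\<^bsub>n-1-i\<^esub>\<close> over \<open>i\<close> is geometric, and the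
  formula follows from polynomial identities modulo \<open>r\<^sub>1 r\<^sub>2 = 1\<close>.
\<close>

section \<open>Characteristic roots and \<open>gam\<close> at integer and half-integer
  indices\<close>

lemma r1_r2:
  assumes "b > 2"
  shows "r1 b * r2 b = 1" "r1 b + r2 b = b" "r1 b > r2 b" "r2 b > 0"
    "(r1 b - r2 b)\<^sup>2 = b\<^sup>2 - 4"
proof -
  have "2\<^sup>2 < b\<^sup>2" using assms by (intro power_strict_mono) auto
  hence pos: "b\<^sup>2 - 4 > 0" by simp
  hence sq: "(sqrt (b\<^sup>2 - 4))\<^sup>2 = b\<^sup>2 - 4" by simp
  have "r1 b * r2 b = (b\<^sup>2 - (sqrt (b\<^sup>2 - 4))\<^sup>2) / 4"
    unfolding r1_def r2_def by (simp add: field_simps power2_eq_square)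
  thus prod: "r1 b * r2 b = 1" unfolding sq by simp
  show "r1 b + r2 b = b" unfolding r1_def r2_def by (simp add: field_simps)
  have "r1 b - r2 b = sqrt (b\<^sup>2 - 4)" unfolding r1_def r2_def by (simp add: field_simps)
  thus "(r1 b - r2 b)\<^sup>2 = b\<^sup>2 - 4" using sq by simp
  show "r1 b > r2 b" using pos unfolding r1_def r2_def by simp
  have "r1 b > 0" using assms pos unfolding r1_def by (intro divide_pos_pos add_pos_nonneg) auto
  thus "r2 b > 0" using prod zero_less_mult_pos[of "r1 b" "r2 b"] by simp
qed

lemma gam_of_nat:
  assumes "b > 2"
  shows "gam b (real k) = r1 b ^ k - r2 b ^ k"
  using r1_r2(3,4)[OF assms] by (simp add: gam_def powr_realpow)

text \<open>The cross term of the square is \<open>-2 * (r1 b * r2 b) powr (k/2) = -2\<close>, which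
  the added 2 cancels.\<close>

lemma gam_half_square:
  assumes "b > 2"
  shows "(gam b (real k / 2))\<^sup>2 + 2 = r1 b ^ k + r2 b ^ k"
proof -
  have pos: "r1 b > 0" "r2 b > 0" using r1_r2(3,4)[OF assms] by auto
  have sq: "(x powr (real k / 2))\<^sup>2 = x ^ k" if "x > 0" for x :: real
    using that by (simp add: powr_power powr_realpow)
  have "r1 b powr (real k / 2) * r2 b powr (real k / 2) = 1"
    using r1_r2(1)[OF assms] pos by (simp flip: powr_mult)
  thus ?thesis
    unfolding gam_def power2_diff using sq pos by simp
qed

definition Tphi :: "real \<Rightarrow> real \<Rightarrow> nat \<Rightarrow> real" where
  "Tphi b c k = (r1 b + (c - b)) * r1 b ^ k - (r2 b + (c - b)) * r2 b ^ k"

text \<open>Closed form of the Casoratian of \<open>Tphi\<close> and its reflection. Both start at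
  \<open>r1 b - r2 b\<close> instead of 1, so for \<open>b > 2\<close> and n at least 2 this is
  \<open>(r1 b - r2 b)^2\<close> times the determinant of \<open>T_tilde n b c\<close>.\<close>

definition Tcas :: "nat \<Rightarrow> real \<Rightarrow> real \<Rightarrow> real" where
  "Tcas n b c = (r1 b - r2 b) *
     ((r1 b + (c - b))\<^sup>2 * r1 b ^ (n - 1) - (r2 b + (c - b))\<^sup>2 * r2 b ^ (n - 1))"

lemma Tphi_0: "Tphi b c 0 = r1 b - r2 b"
  by (simp add: Tphi_def)

lemma Tphi_1:
  assumes "b > 2"
  shows "Tphi b c (Suc 0) = c * Tphi b c 0"
proof -
  have "Tphi b c (Suc 0) = (r1 b + r2 b + (c - b)) * Tphi b c 0"
    by (simp add: Tphi_def algebra_simps)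
  thus ?thesis using r1_r2(2)[OF assms] by simp
qed

lemma Tphi_rec:
  assumes "b > 2"
  shows "Tphi b c (Suc (Suc k)) = b * Tphi b c (Suc k) - Tphi b c k"
proof -
  define x y p q where "x = r1 b" and "y = r2 b" and "p = x ^ k" and "q = y ^ k"
  have "x * y = 1" "x + y = b" using r1_r2(1,2)[OF assms] by (simp_all add: x_def y_def)
  thus ?thesis
    unfolding Tphi_def x_def [symmetric] y_def [symmetric] power_Suc p_def [symmetric] q_def [symmetric]
    by Groebner_Basis.algebra
qed

text \<open>Constancy of the Casoratian: with \<open>n = i + j + 2\<close>, the index
  \<open>j\<close> is the reflection of \<open>Suc i\<close>, and \<open>Suc j\<close> that of
  \<open>i\<close>. The mixed products of \<open>r1 b\<close> and \<open>r2 b\<close> cancel because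
  \<open>r1 b * r2 b = 1\<close>.\<close>

lemma Tcas_step:
  assumes "b > 2"
  shows "Tphi b c (Suc i) * Tphi b c (Suc j) - Tphi b c i * Tphi b c j = Tcas (i + j + 2) b c"
proof -
  define x y p q p' q' where "x = r1 b" and "y = r2 b" and "p = x ^ i" and "q = y ^ i"
    and "p' = x ^ j" and "q' = y ^ j"
  have pw: "z ^ (i + j + 2 - 1) = z * (z ^ i * z ^ j)" for z :: real
    by (simp add: power_add)
  have "x * y = 1" using r1_r2(1)[OF assms] by (simp add: x_def y_def)
  thus ?thesis
    unfolding Tphi_def Tcas_def pw x_def [symmetric] y_def [symmetric] power_Suc
      p_def [symmetric] q_def [symmetric] p'_def [symmetric] q'_def [symmetric]
    by Groebner_Basis.algebra
qed

text \<open>The step at index 0, where the boundary condition gives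
  \<open>Tphi b c 1 = c * Tphi b c 0\<close>. It serves the two corner diagonal entries of the
  product.\<close>

lemma Tcas_boundary:
  assumes "b > 2"
  shows "c * Tphi b c (Suc k) - Tphi b c k = Tcas (Suc (Suc k)) b c / Tphi b c 0"
proof -
  have "(c * Tphi b c (Suc k) - Tphi b c k) * Tphi b c 0 = Tcas (Suc (Suc k)) b c"
    using Tcas_step[OF assms, of c 0 k] Tphi_1[OF assms, of c]
    by (simp add: algebra_simps numeral_2_eq_2)
  moreover have "Tphi b c 0 \<noteq> 0" using r1_r2(3)[OF assms] by (simp add: Tphi_0)
  ultimately show ?thesis by (simp add: field_simps)
qed

section \<open>The inverse up to a scalar factor\<close>

text \<open>For \<open>b > 2\<close> and n at least 2, this is \<open>(r1 b - r2 b)^2\<close> times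
  the adjugate of \<open>T_tilde n b c\<close>.\<close>

definition Tadj :: "nat \<Rightarrow> real \<Rightarrow> real \<Rightarrow> real mat" where
  "Tadj n b c = mat n n (\<lambda>(i, j). Tphi b c (min i j) * Tphi b c (n - 1 - max i j))"

lemma sum_tridiagonal:
  fixes l d u :: "'a :: comm_semiring_0" and f :: "nat \<Rightarrow> 'a"
  assumes "i < n"
  shows "(\<Sum>k<n. (if i = k then d else if i = Suc k then l else if k = Suc i then u else 0) * f k) =
    d * f i + (if i = 0 then 0 else l * f (i - 1)) + (if Suc i < n then u * f (Suc i) else 0)"
proof -
  \<comment> \<open>The three cases are disjoint, so the nested conditional splits into a sum. The
    guard \<open>i \<noteq> 0\<close> matters, since truncated subtraction makes
    \<open>i - 1 = i\<close> at \<open>i = 0\<close>.\<close>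
  have "(\<Sum>k<n. (if i = k then d else if i = Suc k then l else if k = Suc i then u else 0) * f k) =
    (\<Sum>k<n. (if k = i then d * f k else 0) + (if k = i - 1 \<and> i \<noteq> 0 then l * f k else 0)
       + (if k = Suc i then u * f k else 0))"
    by (intro sum.cong) auto
  also have "\<dots> = d * f i + (\<Sum>k<n. if k = i - 1 \<and> i \<noteq> 0 then l * f k else 0)
       + (if Suc i < n then u * f (Suc i) else 0)"
    using assms by (simp add: sum.distrib sum.delta)
  also have "(\<Sum>k<n. if k = i - 1 \<and> i \<noteq> 0 then l * f k else 0) = (if i = 0 then 0 else l * f (i - 1))"
    using assms by (cases "i = 0") (auto simp: sum.delta)
  finally show ?thesis .
qed

lemma T_tilde_mult_Tadj:
  assumes "n \<ge> 2" "b > 2"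
  shows "T_tilde n b c * Tadj n b c = Tcas n b c \<cdot>\<^sub>m 1\<^sub>m n"
proof (rule eq_matI)
  fix i j assume "i < dim_row (Tcas n b c \<cdot>\<^sub>m 1\<^sub>m n)" "j < dim_col (Tcas n b c \<cdot>\<^sub>m 1\<^sub>m n)"
  hence ij: "i < n" "j < n" by auto
  let ?p = "Tphi b c"
  let ?d = "if i = 0 \<or> i = n - 1 then c else b"
  define f where "f k = ?p (min k j) * ?p (n - 1 - max k j)" for k
  have "(T_tilde n b c * Tadj n b c) $$ (i, j) =
      (\<Sum>k<n. (if i = k then ?d else if i = Suc k then -1 else if k = Suc i then -1 else 0) * f k)"
    using ij unfolding T_tilde_def Tadj_def f_def
    by (auto simp: times_mat_def scalar_prod_def lessThan_atLeast0 intro!: sum.cong)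
  also have "\<dots> = ?d * f i + (if i = 0 then 0 else - f (i - 1)) + (if Suc i < n then - f (Suc i) else 0)"
    using sum_tridiagonal[OF ij(1), of ?d "-1" "-1" f] by simp
  also have "\<dots> = (if i = j then Tcas n b c else 0)"
  proof -
    have p0: "?p 0 \<noteq> 0" using r1_r2(3)[OF assms(2)] by (simp add: Tphi_0)
    note p1 = Tphi_1[OF assms(2), of c]
    note rec = Tphi_rec[OF assms(2), of c]
    consider (lt) "i < j" | (eq) "i = j" | (gt) "j < i" by linarith
    thus ?thesis
    proof cases
      case lt
      \<comment> \<open>The neighbours of \<open>i\<close> do not cross the diagonal, so the second
        factor is constant and the row reduces to the recurrence, or to the left boundary condition
        at \<open>i = 0\<close>.\<close>
      hence f: "f i = ?p i * ?p (n - 1 - j)" "f (i - 1) = ?p (i - 1) * ?p (n - 1 - j)"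
          "f (Suc i) = ?p (Suc i) * ?p (n - 1 - j)"
        by (auto simp: f_def min_def max_def)
      have "i \<noteq> n - 1" "Suc i < n" using lt ij by auto
      thus ?thesis using lt unfolding f
        by (cases i) (auto simp: p1 rec algebra_simps)
    next
      case gt
      \<comment> \<open>Counting rows from the bottom mirrors the previous case: the right boundary
        condition becomes \<open>p1\<close> at \<open>m = 0\<close>.\<close>
      define m where "m = n - 1 - i"
      have "j \<le> i - 1" using gt by simp
      have m: "n - 1 - (i - 1) = Suc m" using gt ij by (auto simp: m_def)
      have f: "f i = ?p j * ?p m" "f (i - 1) = ?p j * ?p (Suc m)"
          "f (Suc i) = ?p j * ?p (m - 1)"
        using gt m \<open>j \<le> i - 1\<close> by (simp_all add: f_def min_absorb2 max_absorb1 m_def)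
      have "i \<noteq> 0" "i = n - 1 \<longleftrightarrow> m = 0" "Suc i < n \<longleftrightarrow> m \<noteq> 0" using gt ij by (auto simp: m_def)
      thus ?thesis using gt unfolding f
        by (cases m) (auto simp: p1 rec algebra_simps)
    next
      case eq
      define m where "m = n - 1 - i"
      have n: "n = i + m + 1" using ij by (auto simp: m_def)
      have f: "f i = ?p i * ?p m" "f (i - 1) = ?p (i - 1) * ?p m"
          "f (Suc i) = ?p i * ?p (m - 1)"
        unfolding f_def min_def max_def m_def eq by auto
      have *: "i = n - 1 \<longleftrightarrow> m = 0" "Suc i < n \<longleftrightarrow> m \<noteq> 0" using n by auto
      show ?thesis
      proof (cases i)
        case 0
        \<comment> \<open>Size at least 2 keeps the two corners distinct.\<close>
        then obtain m' where m': "m = Suc m'" using n assms(1) by (cases m) auto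
        show ?thesis using Tcas_boundary[OF assms(2), of c m'] p0 0 m' n eq
          unfolding f * by (simp add: field_simps)
      next
        case (Suc i')
        show ?thesis
        proof (cases m)
          case 0
          thus ?thesis using Tcas_boundary[OF assms(2), of c i'] p0 Suc n eq
            unfolding f * by (simp add: field_simps)
        next
          case (Suc m')
          \<comment> \<open>The recurrence turns \<open>b * ?p i - ?p (i - 1)\<close> into
            \<open>?p (Suc i)\<close>, leaving the Casoratian.\<close>
          thus ?thesis using Tcas_step[OF assms(2), of c i m'] \<open>i = Suc i'\<close> n eq
            unfolding f * by (simp add: rec algebra_simps)
        qed
      qed
    qed
  qed
  also have "\<dots> = (Tcas n b c \<cdot>\<^sub>m 1\<^sub>m n) $$ (i, j)" using ij by simp
  finally show "(T_tilde n b c * Tadj n b c) $$ (i, j) = (Tcas n b c \<cdot>\<^sub>m 1\<^sub>m n) $$ (i, j)" .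
qed (auto simp: T_tilde_def Tadj_def)

text \<open>Multiplying the product formula by the inverse from the left gives the second claim. It
  is kept undivided because \<open>Tcas n b c \<noteq> 0\<close> is itself derived from it.\<close>

lemma T_tilde_inverse:
  assumes "n \<ge> 2" "b > 2" "invertible_mat (T_tilde n b c)"
  shows "Tcas n b c \<noteq> 0"
    and "Tcas n b c \<cdot>\<^sub>m mat_inv (T_tilde n b c) = Tadj n b c"
    and "mat_inv (T_tilde n b c) \<in> carrier_mat n n"
proof -
  define A where "A = T_tilde n b c"
  define B where "B = mat_inv A"
  have A: "A \<in> carrier_mat n n" by (simp add: A_def T_tilde_def)
  have M: "Tadj n b c \<in> carrier_mat n n" by (simp add: Tadj_def)
  have B: "B \<in> carrier_mat n n" and BA: "B * A = 1\<^sub>m n"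
    using mat_inv_invertible(2,3)[OF assms(3)[folded A_def]] A
    by (auto simp: B_def inverts_mat_def)
  have "Tadj n b c = B * (A * Tadj n b c)"
    using assoc_mult_mat[OF B A M] M by (simp add: BA)
  also have "\<dots> = Tcas n b c \<cdot>\<^sub>m B"
    using B unfolding A_def T_tilde_mult_Tadj[OF assms(1,2)]
    by (subst mult_smult_distrib[of _ n n _ n]) auto
  finally have eq: "Tcas n b c \<cdot>\<^sub>m B = Tadj n b c" ..
  thus "Tcas n b c \<cdot>\<^sub>m mat_inv (T_tilde n b c) = Tadj n b c"
    by (simp add: A_def B_def)
  show "mat_inv (T_tilde n b c) \<in> carrier_mat n n" using B by (simp add: A_def B_def)
  \<comment> \<open>\<open>W = 0\<close> would make the whole of \<^const>\<open>Tadj\<close> vanish, but its corner entry does not.\<close>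
  have "Tadj n b c $$ (0, n - 1) = (Tphi b c 0)\<^sup>2"
    using assms(1) by (simp add: Tadj_def power2_eq_square)
  hence "Tadj n b c $$ (0, n - 1) \<noteq> 0" using r1_r2(3)[OF assms(2)] by (simp add: Tphi_0)
  moreover have "Tadj n b c $$ (0, n - 1) = Tcas n b c * B $$ (0, n - 1)"
    using B assms(1) by (simp flip: eq)
  ultimately show "Tcas n b c \<noteq> 0" by auto
qed

section \<open>The trace as a closed form and its comparison with \<open>K1\<close> and
  \<open>K2\<close>\<close>

text \<open>The pure powers in each summand do not depend on \<open>i\<close>, which gives the
  factor \<open>n\<close>. The mixed products form two mirror-image geometric sums, and the factor
  \<open>r1 b - r2 b\<close> clears their denominators.\<close>

lemma sum_Tphi:
  shows "(r1 b - r2 b) * (\<Sum>i<n. Tphi b c i * Tphi b c (n - 1 - i)) =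
    (r1 b - r2 b) * real n * ((r1 b + (c - b))\<^sup>2 * r1 b ^ (n - 1) + (r2 b + (c - b))\<^sup>2 * r2 b ^ (n - 1))
    - 2 * (r1 b + (c - b)) * (r2 b + (c - b)) * (r1 b ^ n - r2 b ^ n)"
proof -
  define x y where "x = r1 b" and "y = r2 b"
  define \<alpha> \<beta> where "\<alpha> = x + (c - b)" and "\<beta> = y + (c - b)"
  have geo: "(x - y) * (\<Sum>i<n. x ^ i * y ^ (n - 1 - i)) = x ^ n - y ^ n"
    using power_diff_sumr2[of x n y] by (simp add: mult.commute)
  have geo': "(x - y) * (\<Sum>i<n. y ^ i * x ^ (n - 1 - i)) = x ^ n - y ^ n"
    using power_diff_sumr2[of y n x] by (simp add: algebra_simps)
  have "(\<Sum>i<n. Tphi b c i * Tphi b c (n - 1 - i)) =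
    (\<Sum>i<n. (\<alpha>\<^sup>2 * x ^ (n - 1) + \<beta>\<^sup>2 * y ^ (n - 1))
      - \<alpha> * \<beta> * (x ^ i * y ^ (n - 1 - i)) - \<alpha> * \<beta> * (y ^ i * x ^ (n - 1 - i)))"
  proof (rule sum.cong[OF refl])
    fix i assume "i \<in> {..<n}"
    hence "z ^ (n - 1) = z ^ i * z ^ (n - 1 - i)" for z :: real
      by (simp flip: power_add)
    thus "Tphi b c i * Tphi b c (n - 1 - i) = (\<alpha>\<^sup>2 * x ^ (n - 1) + \<beta>\<^sup>2 * y ^ (n - 1))
      - \<alpha> * \<beta> * (x ^ i * y ^ (n - 1 - i)) - \<alpha> * \<beta> * (y ^ i * x ^ (n - 1 - i))"
      unfolding Tphi_def x_def [symmetric] y_def [symmetric] \<alpha>_def [symmetric] \<beta>_def [symmetric]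
      by (simp add: algebra_simps power2_eq_square)
  qed
  also have "\<dots> = real n * (\<alpha>\<^sup>2 * x ^ (n - 1) + \<beta>\<^sup>2 * y ^ (n - 1))
      - \<alpha> * \<beta> * (\<Sum>i<n. x ^ i * y ^ (n - 1 - i)) - \<alpha> * \<beta> * (\<Sum>i<n. y ^ i * x ^ (n - 1 - i))"
    by (simp add: sum_subtractf sum_distrib_left)
  finally have "(x - y) * (\<Sum>i<n. Tphi b c i * Tphi b c (n - 1 - i)) =
      (x - y) * real n * (\<alpha>\<^sup>2 * x ^ (n - 1) + \<beta>\<^sup>2 * y ^ (n - 1))
      - \<alpha> * \<beta> * ((x - y) * (\<Sum>i<n. x ^ i * y ^ (n - 1 - i)))
      - \<alpha> * \<beta> * ((x - y) * (\<Sum>i<n. y ^ i * x ^ (n - 1 - i)))"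
    by (simp only: right_diff_distrib mult.left_commute mult.assoc)
  thus ?thesis
    unfolding geo geo' x_def [symmetric] y_def [symmetric] \<alpha>_def [symmetric] \<beta>_def [symmetric]
    by simp
qed

text \<open>With \<open>p\<close> and \<open>q\<close> for the powers of exponent
  \<open>n - 1\<close>, and \<open>N\<close> for \<open>n\<close>, only \<open>x * y = 1\<close> and
  \<open>p * q = 1\<close> are needed to relate the powers. \<open>G\<close> is gamma at
  \<open>n + 1\<close>, \<open>h\<close> is the squared half-index gamma plus 2, and
  \<open>u\<close> is the bracket in \<open>K1\<close> and \<open>K2\<close>.\<close>

lemma trace_formula_algebra:
  fixes x y p q d N b s :: real
  assumes xy: "x * y = 1" and pq: "p * q = 1" and b: "b = x + y" and s: "s = x - y"
    and s0: "s \<noteq> 0" and G0: "x\<^sup>2 * p - y\<^sup>2 * q \<noteq> 0"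
    and W0: "(x + d)\<^sup>2 * p - (y + d)\<^sup>2 * q \<noteq> 0"
  defines "G \<equiv> x\<^sup>2 * p - y\<^sup>2 * q" and "h \<equiv> x\<^sup>2 * p + y\<^sup>2 * q"
    and "u \<equiv> x\<^sup>2 * p - y\<^sup>2 * q + d * (x * p - y * q)"
    and "w \<equiv> (x + d)\<^sup>2 * p - (y + d)\<^sup>2 * q"
  shows "(s * N * ((x + d)\<^sup>2 * p + (y + d)\<^sup>2 * q) - 2 * (x + d) * (y + d) * (x * p - y * q)) / (s\<^sup>2 * w) =
    (u\<^sup>2 + d\<^sup>2 * s\<^sup>2) / (u\<^sup>2 - d\<^sup>2 * s\<^sup>2) * ((N + 1) / s * (h / G) - b / s\<^sup>2)
    - d * u / (u\<^sup>2 - d\<^sup>2 * s\<^sup>2) * (b / s * h - G - 4 * (N + 1) / G)"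
proof -
  \<comment> \<open>The common denominator of \<open>K1\<close> and \<open>K2\<close> factors, hence
    is nonzero whenever the Casoratian and \<open>G\<close> are.\<close>
  have D: "u\<^sup>2 - d\<^sup>2 * s\<^sup>2 = w * G"
    using xy pq unfolding u_def s w_def G_def by Groebner_Basis.algebra
  \<comment> \<open>Both sides of \<open>num\<close> are affine in \<open>N\<close>:
    \<open>lin\<close> compares the coefficients of \<open>N\<close> (up to a factor
    \<open>s\<close>), \<open>const\<close> the terms free of \<open>N\<close>.\<close>
  have lin: "(u\<^sup>2 + d\<^sup>2 * s\<^sup>2) * h + 4 * d * u * s = ((x + d)\<^sup>2 * p + (y + d)\<^sup>2 * q) * G\<^sup>2"
    using xy pq unfolding u_def s h_def G_def by Groebner_Basis.algebra
  have const: "(u\<^sup>2 + d\<^sup>2 * s\<^sup>2) * (h * s - b * G) - d * u * (b * h * s * G - s\<^sup>2 * G\<^sup>2 - 4 * s\<^sup>2)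
      = - (2 * (x + d) * (y + d) * (x * p - y * q)) * G\<^sup>2"
    using xy pq unfolding u_def s h_def G_def b by Groebner_Basis.algebra
  have GW: "G \<noteq> 0" "w \<noteq> 0" using G0 W0 by (simp_all add: G_def w_def)
  have num: "(u\<^sup>2 + d\<^sup>2 * s\<^sup>2) * ((N + 1) * h * s - b * G) - d * u * (b * s * h * G - s\<^sup>2 * G\<^sup>2 - 4 * (N + 1) * s\<^sup>2)
    = (s * N * ((x + d)\<^sup>2 * p + (y + d)\<^sup>2 * q) - 2 * (x + d) * (y + d) * (x * p - y * q)) * G\<^sup>2"
    using lin const by Groebner_Basis.algebra
  have "(u\<^sup>2 + d\<^sup>2 * s\<^sup>2) / (w * G) * ((N + 1) / s * (h / G) - b / s\<^sup>2)
    - d * u / (w * G) * (b / s * h - G - 4 * (N + 1) / G) =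
    ((u\<^sup>2 + d\<^sup>2 * s\<^sup>2) * ((N + 1) * h * s - b * G) - d * u * (b * s * h * G - s\<^sup>2 * G\<^sup>2 - 4 * (N + 1) * s\<^sup>2))
     / (w * G * (s\<^sup>2 * G))"
  proof -
    have "(N + 1) / s * (h / G) - b / s\<^sup>2 = ((N + 1) * h * s - b * G) / (s\<^sup>2 * G)"
      using GW s0 by (simp add: divide_simps power2_eq_square)
    moreover have "b / s * h - G - 4 * (N + 1) / G =
        (b * s * h * G - s\<^sup>2 * G\<^sup>2 - 4 * (N + 1) * s\<^sup>2) / (s\<^sup>2 * G)"
      using GW s0 by (simp add: field_simps power2_eq_square)
    ultimately show ?thesis
      by (simp only: times_divide_times_eq flip: diff_divide_distrib)
  qed
  thus ?thesis
    unfolding D num using GW s0 by (simp add: power2_eq_square mult.assoc)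
qed

theorem theorem3p5:
  fixes n :: nat and b c :: real
  assumes "n \<ge> 3" and "b > 2" and "invertible_mat (T_tilde n b c)"
  shows "mat_trace (mat_inv (T_tilde n b c)) =
    K1 n b c *
      ((real n + 1) / sqrt (b\<^sup>2 - 4) *
         (((gam b ((real n + 1) / 2))\<^sup>2 + 2) / gam b (real n + 1))
       - b / (b\<^sup>2 - 4))
    - K2 n b c *
      (b / sqrt (b\<^sup>2 - 4) * ((gam b ((real n + 1) / 2))\<^sup>2 + 2)
       - gam b (real n + 1)
       - 4 * (real n + 1) / gam b (real n + 1))"
proof -
  define B where "B = mat_inv (T_tilde n b c)"
  define x y d s p q where "x = r1 b" and "y = r2 b" and "d = c - b" and "s = x - y"
    and "p = x ^ (n - 1)" and "q = y ^ (n - 1)"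
  define S where "S = s * real n * ((x + d)\<^sup>2 * p + (y + d)\<^sup>2 * q) - 2 * (x + d) * (y + d) * (x * p - y * q)"
  have n2: "n \<ge> 2" using assms(1) by simp
  note r = r1_r2[OF assms(2), folded x_def y_def]
  note T = T_tilde_inverse[OF n2 assms(2,3), folded B_def]
  have pw: "x ^ n = x * p" "y ^ n = y * q" "x ^ Suc n = x\<^sup>2 * p" "y ^ Suc n = y\<^sup>2 * q"
    using n2 by (cases n; simp add: p_def q_def power2_eq_square)+
  have g: "gam b (real n) = x * p - y * q" "gam b (real n + 1) = x\<^sup>2 * p - y\<^sup>2 * q"
    "(gam b ((real n + 1) / 2))\<^sup>2 + 2 = x\<^sup>2 * p + y\<^sup>2 * q"
    using gam_of_nat[OF assms(2), of n] gam_of_nat[OF assms(2), of "Suc n"]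
      gam_half_square[OF assms(2), of "Suc n"]
    unfolding x_def [symmetric] y_def [symmetric] pw by (simp_all add: add.commute)
  \<comment> \<open>The sign identifies \<open>s\<close> with the square root of
    \<open>b^2 - 4\<close>, not its negative.\<close>
  have "s > 0" using r(3) by (simp add: s_def)
  hence "sqrt (s\<^sup>2) = s" "s \<noteq> 0" by simp_all
  note s = r(5)[folded s_def, symmetric] this
  have W: "Tcas n b c = s * ((x + d)\<^sup>2 * p - (y + d)\<^sup>2 * q)"
    by (simp add: Tcas_def x_def y_def d_def s_def p_def q_def)
  \<comment> \<open>Scaling by the Casoratian replaces the inverse by \<open>Tadj\<close>, whose
    diagonal entries are the products summed in \<open>sum_Tphi\<close>.\<close>
  have "Tcas n b c * mat_trace B = (\<Sum>i<n. (Tcas n b c \<cdot>\<^sub>m B) $$ (i, i))"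
    using T(3) by (simp add: mat_trace_def sum_distrib_left)
  also have "\<dots> = (\<Sum>i<n. Tphi b c i * Tphi b c (n - 1 - i))"
    unfolding T(2) by (simp add: Tadj_def)
  finally have "s * (Tcas n b c * mat_trace B) = S"
    using sum_Tphi[of b c n]
    unfolding S_def x_def [symmetric] y_def [symmetric] d_def [symmetric] s_def [symmetric] pw
      p_def [symmetric] q_def [symmetric] by simp
  hence "mat_trace B = S / (s * Tcas n b c)"
    using T(1) s(3) by (simp add: nonzero_eq_divide_eq mult_ac)
  hence tr: "mat_trace B = S / (s\<^sup>2 * ((x + d)\<^sup>2 * p - (y + d)\<^sup>2 * q))"
    unfolding W by (simp only: power2_eq_square mult.assoc)
  have "y ^ Suc n < x ^ Suc n" using r by (intro power_strict_mono) auto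
  hence G0: "x\<^sup>2 * p - y\<^sup>2 * q \<noteq> 0" unfolding pw by simp
  have pq: "p * q = 1" using r(1) by (simp add: p_def q_def flip: power_mult_distrib)
  have W0: "(x + d)\<^sup>2 * p - (y + d)\<^sup>2 * q \<noteq> 0" using T(1) unfolding W by simp
  show ?thesis
    unfolding B_def [symmetric] tr K1_def K2_def g s(1) s(2) d_def [symmetric] S_def
    by (rule trace_formula_algebra[OF r(1) pq r(2)[symmetric] s_def s(3) G0 W0])
qed

end
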